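(* Let $(\mathfrak g,B)=(\mathbb CX_1\oplus\mathbb CY_1)\oplus\mathfrak q$ and $(\mathfrak g',B')=(\mathbb CX_1'\oplus\mathbb CY_1')\oplus\mathfrak q'$ be double extensions of the quadratic vector spaces $(\mathfrak q,\overline B)$ and $(\mathfrak q',\overline{B'})$ by skew-symmetric maps $\overline C$ and $\overline{C'}$ respectively, where $\overline B=B|_{\mathfrak q\times\mathfrak q}$ and $\overline{B'}=B'|_{\mathfrak q'\times\mathfrak q'}$. Then: (1) there exists an i-isomorphism between $\mathfrak g$ and $\mathfrak g'$ if and only if there exists an isometry $\overline A:\mathfrak q\to\mathfrak q'$ such that $\overline{C'}=\lambda\,\overline A\,\overline C\,\overline A^{-1}$ for some non-zero $\lambda\in\mathbb C$; (2) there exists a Lie algebra isomorphism between $\mathfrak g$ and $\mathfrak g'$ if and only if there exist invertible linear maps $\overline Q:\mathfrak q\to\mathfrak q'$ and $\overline P:\mathfrak q\to\mathfrak q$ such that (i) $\overline{C'}=\lambda\,\overline Q\,\overline C\,\overline Q^{-1}$ for some non-zero $\lambda\in\mathbb C$, (ii) $\overline P^*\,\overline P\,\overline C=\overline C$, and (iii) $\overline Q\,\overline P^{-1}$ is an isometry from $\mathfrak q$ onto $\mathfrak q'$.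
   Context: All vector spaces are finite-dimensional over $\mathbb C$. A quadratic vector space is a vector space with a non-degenerate symmetric bilinear form. $\overline P^*$ is the adjoint of $\overline P$ with respect to $\overline B$. A quadratic Lie algebra is a Lie algebra with a non-degenerate symmetric invariant bilinear form; an i-isomorphism is a Lie algebra isomorphism that is an isometry. The double extension of $(\mathfrak q,B_{\mathfrak q})$ by a skew-symmetric map $\overline C:\mathfrak q\to\mathfrak q$ is the orthogonal direct sum $(\mathbb CX_1\oplus\mathbb CY_1)\oplus\mathfrak q$, with form $B$ extending $B_{\mathfrak q}$ and $B(X_1,X_1)=B(Y_1,Y_1)=0$, $B(X_1,Y_1)=1$, and bracket $[X+\lambda X_1+\mu Y_1,\,Y+\lambda'X_1+\mu'Y_1]=\mu\overline C(Y)-\mu'\overline C(X)+B(\overline C(X),Y)X_1$ for $X,Y\in\mathfrak q$, $\lambda,\mu,\lambda',\mu'\in\mathbb C$. It is a quadratic Lie algebra. *)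

theory Defs
  imports Complex_Main "HOL-Library.Product_Plus"
begin

text \<open>Quadratic vector spaces and (quadratic) Lie algebras are carried by whole types, with an
  explicit complex scalar multiplication.  The zero-dimensional space is allowed.\<close>

definition bilinear_map ::
  "(complex \<Rightarrow> 'a::ab_group_add \<Rightarrow> 'a) \<Rightarrow> (complex \<Rightarrow> 'b::ab_group_add \<Rightarrow> 'b) \<Rightarrow>
   ('a \<Rightarrow> 'a \<Rightarrow> 'b) \<Rightarrow> bool" where
  "bilinear_map s t f \<longleftrightarrow>
     (\<forall>x. Vector_Spaces.linear s t (f x)) \<and> (\<forall>y. Vector_Spaces.linear s t (\<lambda>x. f x y))"

locale complex_fd_space = vector_space scale
  for scale :: "complex \<Rightarrow> 'a::ab_group_add \<Rightarrow> 'a" +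
  assumes finite_dim: "\<exists>S. finite S \<and> span S = UNIV"

locale quadratic_space = complex_fd_space scale
  for scale :: "complex \<Rightarrow> 'a::ab_group_add \<Rightarrow> 'a" and B :: "'a \<Rightarrow> 'a \<Rightarrow> complex" +
  assumes form_bilinear: "bilinear_map scale (*) B"
    and form_sym: "B x y = B y x"
    and form_nondeg: "(\<And>y. B x y = 0) \<Longrightarrow> x = 0"

locale lie_algebra = complex_fd_space scale
  for scale :: "complex \<Rightarrow> 'a::ab_group_add \<Rightarrow> 'a" and br :: "'a \<Rightarrow> 'a \<Rightarrow> 'a" +
  assumes br_bilinear: "bilinear_map scale scale br"
    and br_alt: "br x x = 0"
    and br_jacobi: "br x (br y z) + br y (br z x) + br z (br x y) = 0"

locale quadratic_lie_algebra = quadratic_space scale B + lie_algebra scale br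
  for scale :: "complex \<Rightarrow> 'a::ab_group_add \<Rightarrow> 'a"
    and B :: "'a \<Rightarrow> 'a \<Rightarrow> complex" and br :: "'a \<Rightarrow> 'a \<Rightarrow> 'a" +
  assumes form_invariant: "B (br x y) z = B x (br y z)"

definition skew_symmetric_map ::
  "(complex \<Rightarrow> 'a::ab_group_add \<Rightarrow> 'a) \<Rightarrow> ('a \<Rightarrow> 'a \<Rightarrow> complex) \<Rightarrow> ('a \<Rightarrow> 'a) \<Rightarrow> bool" where
  "skew_symmetric_map s B C \<longleftrightarrow>
     Vector_Spaces.linear s s C \<and> (\<forall>x y. B (C x) y = - B x (C y))"

definition form_adjoint :: "('a \<Rightarrow> 'a \<Rightarrow> complex) \<Rightarrow> ('a \<Rightarrow> 'a) \<Rightarrow> 'a \<Rightarrow> 'a" where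
  "form_adjoint B P = (THE P'. \<forall>x y. B (P x) y = B x (P' y))"

definition linear_iso ::
  "(complex \<Rightarrow> 'a::ab_group_add \<Rightarrow> 'a) \<Rightarrow> (complex \<Rightarrow> 'b::ab_group_add \<Rightarrow> 'b) \<Rightarrow>
   ('a \<Rightarrow> 'b) \<Rightarrow> bool" where
  "linear_iso s t f \<longleftrightarrow> Vector_Spaces.linear s t f \<and> bij f"

definition isometry ::
  "(complex \<Rightarrow> 'a::ab_group_add \<Rightarrow> 'a) \<Rightarrow> ('a \<Rightarrow> 'a \<Rightarrow> complex) \<Rightarrow>
   (complex \<Rightarrow> 'b::ab_group_add \<Rightarrow> 'b) \<Rightarrow> ('b \<Rightarrow> 'b \<Rightarrow> complex) \<Rightarrow> ('a \<Rightarrow> 'b) \<Rightarrow> bool" where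
  "isometry s B t B' f \<longleftrightarrow> linear_iso s t f \<and> (\<forall>x y. B' (f x) (f y) = B x y)"

definition lie_iso ::
  "(complex \<Rightarrow> 'a::ab_group_add \<Rightarrow> 'a) \<Rightarrow> ('a \<Rightarrow> 'a \<Rightarrow> 'a) \<Rightarrow>
   (complex \<Rightarrow> 'b::ab_group_add \<Rightarrow> 'b) \<Rightarrow> ('b \<Rightarrow> 'b \<Rightarrow> 'b) \<Rightarrow> ('a \<Rightarrow> 'b) \<Rightarrow> bool" where
  "lie_iso s br t br' f \<longleftrightarrow> linear_iso s t f \<and> (\<forall>x y. f (br x y) = br' (f x) (f y))"

definition i_iso ::
  "(complex \<Rightarrow> 'a::ab_group_add \<Rightarrow> 'a) \<Rightarrow> ('a \<Rightarrow> 'a \<Rightarrow> complex) \<Rightarrow> ('a \<Rightarrow> 'a \<Rightarrow> 'a) \<Rightarrow>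
   (complex \<Rightarrow> 'b::ab_group_add \<Rightarrow> 'b) \<Rightarrow> ('b \<Rightarrow> 'b \<Rightarrow> complex) \<Rightarrow> ('b \<Rightarrow> 'b \<Rightarrow> 'b) \<Rightarrow>
   ('a \<Rightarrow> 'b) \<Rightarrow> bool" where
  "i_iso s B br t B' br' f \<longleftrightarrow> lie_iso s br t br' f \<and> isometry s B t B' f"

text \<open>The double extension lives on triples: \<open>((l, m), x)\<close> stands for \<open>x + l X\<^sub>1 + m Y\<^sub>1\<close>.\<close>

type_synonym 'a dext = "(complex \<times> complex) \<times> 'a"

fun dext_scale :: "(complex \<Rightarrow> 'a \<Rightarrow> 'a) \<Rightarrow> complex \<Rightarrow> 'a dext \<Rightarrow> 'a dext" where
  "dext_scale s c ((l, m), x) = ((c * l, c * m), s c x)"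

fun dext_form :: "('a \<Rightarrow> 'a \<Rightarrow> complex) \<Rightarrow> 'a dext \<Rightarrow> 'a dext \<Rightarrow> complex" where
  "dext_form B ((l, m), x) ((l', m'), y) = l * m' + m * l' + B x y"

fun dext_bracket ::
  "(complex \<Rightarrow> 'a::ab_group_add \<Rightarrow> 'a) \<Rightarrow> ('a \<Rightarrow> 'a \<Rightarrow> complex) \<Rightarrow> ('a \<Rightarrow> 'a) \<Rightarrow>
   'a dext \<Rightarrow> 'a dext \<Rightarrow> 'a dext" where
  "dext_bracket s B C ((l, m), x) ((l', m'), y) = ((B (C x) y, 0), s m (C y) - s m' (C x))"

lemma (in quadratic_space) form_adjoint:
  assumes "Vector_Spaces.linear scale scale P"
  shows "B (P x) y = B x (form_adjoint B P y)"
proof -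
  have linL: "Vector_Spaces.linear scale (*) (\<lambda>x. B x y)" 
    and linR: "Vector_Spaces.linear scale (*) (B x)" for x y
    using form_bilinear by (auto simp: bilinear_map_def)
  have diffR: "B x (u - v) = B x u - B x v" for x u v
  proof -
    have "B x ((u - v) + v) = B x (u - v) + B x v"
      using linR[of x] unfolding Vector_Spaces.linear_iff by blast
    then show ?thesis by simp
  qed
  have diffL: "B (u - v) x = B u x - B v x" for x u v
    using diffR[of x u v] form_sym[of _ x] by simp
  obtain S where S: "finite S" "span S = UNIV" using finite_dim by blast
  obtain Bs where Bs: "Bs \<subseteq> S" "independent Bs" "S \<subseteq> span Bs"
    using maximal_independent_subset by blast
  have finB: "finite Bs" using S Bs finite_subset by blast
  have spB: "span Bs = UNIV" using S Bs span_minimal subspace_span by blast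
  interpret fd: finite_dimensional_vector_space scale Bs
    by unfold_locales (use finB Bs spB in auto)
  have repr: "\<exists>v. \<forall>x. f x = B x v" if f: "Vector_Spaces.linear scale (*) f" for f
  proof -
    define T where "T v = (\<Sum>b\<in>Bs. scale (B b v) b)" for v
    have uniq: "g b = h b" if "(\<Sum>b\<in>Bs. scale (g b) b) = (\<Sum>b\<in>Bs. scale (h b) b)" "b \<in> Bs"
      for g h :: "'a \<Rightarrow> complex" and b
    proof -
      have "(\<Sum>b\<in>Bs. scale (g b - h b) b) = 0"
        using that(1) by (simp add: scale_left_diff_distrib sum_subtractf)
      then have "g b - h b = 0"
        using independentD[OF Bs(2) finB order_refl, of "\<lambda>b. g b - h b"] that(2) by blast
      then show ?thesis by simp
    qed
    have ext: "g = h" if g: "Vector_Spaces.linear scale (*) g" and h: "Vector_Spaces.linear scale (*) h"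
      and e: "\<And>b. b \<in> Bs \<Longrightarrow> g b = h b" for g h :: "'a \<Rightarrow> complex"
    proof
      fix x
      interpret vector_space_pair scale "(*) :: complex \<Rightarrow> complex \<Rightarrow> complex"
        by unfold_locales (auto simp: algebra_simps)
      show "g x = h x" using linear_eq_on[OF g h, of x Bs] e spB by auto
    qed
    have Tlin: "Vector_Spaces.linear scale scale T"
    proof -
      have a: "B b (u + v) = B b u + B b v" "B b (scale c u) = c * B b u" for b u v c
        using linR[of b] by (simp_all add: Vector_Spaces.linear_iff)
      have "vector_space scale" by unfold_locales
      then show ?thesis unfolding Vector_Spaces.linear_iff T_def
        by (simp add: a scale_left_distrib sum.distrib scale_sum_right)
    qed
    have "inj T"
    proof (rule injI)
      fix u v assume "T u = T v"
      then have "\<And>b. b \<in> Bs \<Longrightarrow> B b u = B b v" unfolding T_def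
        using uniq[of "\<lambda>b. B b u" "\<lambda>b. B b v"] by blast
      then have eq: "(\<lambda>b. B b u) = (\<lambda>b. B b v)" by (intro ext linL)
      have "B (u - v) y = 0" for y
      proof -
        have "B y (u - v) = B y u - B y v" 
          by (rule diffR)
        also have "\<dots> = 0" using fun_cong[OF eq, of y] by simp
        finally show ?thesis using form_sym[of y "u - v"] by simp
      qed
      then show "u = v" using form_nondeg[of "u - v"] by simp
    qed
    then have "surj T" using fd.linear_inj_imp_surj[OF Tlin] by blast
    then obtain v where v: "T v = (\<Sum>b\<in>Bs. scale (f b) b)" by (metis surjD)
    then have "\<And>b. b \<in> Bs \<Longrightarrow> B b v = f b" unfolding T_def
      using uniq[of "\<lambda>b. B b v" f] by blast
    then have "(\<lambda>x. B x v) = f" by (intro ext linL f)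
    then show ?thesis by auto
  qed
  have "\<exists>v. \<forall>x. B (P x) y = B x v" for y
  proof (rule repr)
    show "Vector_Spaces.linear scale (*) (\<lambda>x. B (P x) y)"
      using linL[of y] assms by (simp add: Vector_Spaces.linear_iff)
  qed
  then have "\<exists>P'. \<forall>y x. B (P x) y = B x (P' y)" by (intro choice allI)
  then obtain P' where P': "\<And>x y. B (P x) y = B x (P' y)" by blast
  have "\<exists>!P'. \<forall>x y. B (P x) y = B x (P' y)"
  proof (rule ex1I[of _ P'])
    show "\<forall>x y. B (P x) y = B x (P' y)" using P' by blast
    fix P'' assume a: "\<forall>x y. B (P x) y = B x (P'' y)"
    show "P'' = P'"
    proof
      fix y
      have "B (P'' y - P' y) x = 0" for x
      proof -
        have "B (P'' y - P' y) x = B (P'' y) x - B (P' y) x"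
          by (rule diffL)
        also have "\<dots> = 0" using a P'[of x y] form_sym[of _ x] by simp
        finally show ?thesis .
      qed
      then show "P'' y = P' y" using form_nondeg[of "P'' y - P' y"] by simp
    qed
  qed
  from theI'[OF this] show ?thesis unfolding form_adjoint_def by blast
qed

lemma double_extension_quadratic_lie_algebra:
  assumes "quadratic_space s B" and C: "skew_symmetric_map s B C"
  shows "quadratic_lie_algebra (dext_scale s) (dext_form B) (dext_bracket s B C)"
proof -
  interpret quadratic_space s B by fact
  have BL: "B (x + x') y = B x y + B x' y" "B (s c x) y = c * B x y"
    and BR: "B x (y + y') = B x y + B x y'" "B x (s c y) = c * B x y" for c x x' y y'
    using form_bilinear by (simp_all add: bilinear_map_def Vector_Spaces.linear_iff)
  have B0: "B 0 y = 0" "B x 0 = 0" for x y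
    using BL(2)[of 0] BR(2)[of _ 0] by auto
  have BD: "B (x - x') y = B x y - B x' y" "B x (y - y') = B x y - B x y'" for x x' y y'
    using BL(1)[of "x - x'" x' y] BR(1)[of x "y - y'" y'] by (simp_all add: eq_diff_eq)
  have Cl: "C (x + y) = C x + C y" "C (s c x) = s c (C x)" for c x y
    using C by (simp_all add: skew_symmetric_map_def Vector_Spaces.linear_iff)
  have CD: "C (x - y) = C x - C y" for x y using Cl(1)[of "x - y" y] by auto
  have sk: "B (C x) y = - B (C y) x" for x y
    using C form_sym by (metis skew_symmetric_map_def)
  have Cxx: "B (C x) x = 0" for x using sk[of x x] by simp
  have vs: "vector_space (dext_scale s)"
    by unfold_locales (auto simp: algebra_simps scale_right_distrib scale_left_distrib)
  interpret d: vector_space "dext_scale s" by (rule vs)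
  have mulvs: "vector_space ((*) :: complex \<Rightarrow> complex \<Rightarrow> complex)"
    by unfold_locales (auto simp: algebra_simps)
  have fin: "\<exists>S. finite S \<and> d.span S = UNIV"
  proof -
    obtain S where S: "finite S" "span S = UNIV" using finite_dim by blast
    define X1 Y1 :: "'a dext" where "X1 = ((1,0),0)" and "Y1 = ((0,1),0)"
    define T where "T = insert X1 (insert Y1 (Pair 0 ` S))"
    have q: "(0, x) \<in> d.span T" for x
    proof -
      have "x \<in> span S" using S by simp
      then show ?thesis
      proof (induction rule: span_induct_alt)
        case base
        then show ?case using d.span_zero[of T] by (simp add: zero_prod_def)
      next
        case (step c u v)
        have "(0, u) \<in> d.span T" using step by (intro d.span_base) (auto simp: T_def)
        then have "dext_scale s c (0, u) + (0, v) \<in> d.span T" 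
          using step by (intro d.span_add d.span_scale)
        then show ?case by (simp add: zero_prod_def)
      qed
    qed
    have "((l, m), x) \<in> d.span T" for l m x
    proof -
      have "dext_scale s l X1 + (dext_scale s m Y1 + (0, x)) \<in> d.span T"
        by (intro d.span_add d.span_scale d.span_base q) (auto simp: T_def)
      then show ?thesis by (simp add: X1_def Y1_def zero_prod_def)
    qed
    moreover have "finite T" using S by (simp add: T_def)
    ultimately show ?thesis by auto
  qed
  show ?thesis
  proof (unfold_locales, fact fin)
    show "bilinear_map (dext_scale s) (*) (dext_form B)"
      by (auto simp: bilinear_map_def Vector_Spaces.linear_iff vs mulvs BL BR algebra_simps)
    show "dext_form B x y = dext_form B y x" for x y
      by (cases x; cases y) (auto simp: form_sym)
    show "x = 0" if "\<And>y. dext_form B x y = 0" for x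
    proof -
      obtain l m u where x: "x = ((l, m), u)" by (metis surj_pair)
      have "l = 0" using that[of "((0,1),0)"] by (simp add: x B0)
      moreover have "m = 0" using that[of "((1,0),0)"] by (simp add: x B0)
      moreover have "u = 0" 
        by (rule form_nondeg) (use that[of "((0,0),_)"] in \<open>simp add: x\<close>)
      ultimately show ?thesis by (simp add: x zero_prod_def)
    qed
    show "bilinear_map (dext_scale s) (dext_scale s) (dext_bracket s B C)"
      by (auto simp: bilinear_map_def Vector_Spaces.linear_iff vs BL BR Cl algebra_simps
          scale_right_distrib scale_left_distrib scale_right_diff_distrib)
    show "dext_bracket s B C x x = 0" for x
      by (cases x) (auto simp: Cxx zero_prod_def)
    show "dext_bracket s B C x (dext_bracket s B C y z) +
          dext_bracket s B C y (dext_bracket s B C z x) +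
          dext_bracket s B C z (dext_bracket s B C x y) = 0" for x y z
    proof -
      obtain l m u l' m' v l'' m'' w
        where e: "x = ((l, m), u)" "y = ((l', m'), v)" "z = ((l'', m''), w)"
        using that[of "fst (fst x)" "snd (fst x)" "snd x" "fst (fst y)" "snd (fst y)" "snd y"
            "fst (fst z)" "snd (fst z)" "snd z"] by simp
      have sy: "B (C v) (C u) = B (C u) (C v)" "B (C w) (C u) = B (C u) (C w)"
        "B (C w) (C v) = B (C v) (C w)" by (simp_all add: form_sym)
      show ?thesis
        by (simp add: e zero_prod_def BR BD Cl CD scale_right_diff_distrib sy mult.commute)
    qed
    show "dext_form B (dext_bracket s B C x y) z = dext_form B x (dext_bracket s B C y z)" for x y z
    proof -
      obtain l m u l' m' v l'' m'' w
        where e: "x = ((l, m), u)" "y = ((l', m'), v)" "z = ((l'', m''), w)"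
        using that[of "fst (fst x)" "snd (fst x)" "snd x" "fst (fst y)" "snd (fst y)" "snd y"
            "fst (fst z)" "snd (fst z)" "snd z"] by simp
      have "B u (C w) = - B (C u) w" "B u (C v) = - B (C u) v"
        using C by (auto simp: skew_symmetric_map_def)
      then show ?thesis by (simp add: e BL BD BR algebra_simps)
    qed
  qed
qed

end

theory Submission
  imports Defs
begin

text \<open>
  Write \<open>\<hh> = \<complex>X\<^sub>1 \<oplus> \<qq>\<close> and \<open>\<hh>' = \<complex>X\<^sub>1' \<oplus> \<qq>'\<close> for the hyperplanes on which the
  \<open>Y\<^sub>1\<close>-coordinate vanishes.

  Suppose first that a Lie algebra isomorphism \<open>f\<close> maps \<open>\<hh>\<close> into \<open>\<hh>'\<close> and that \<open>C \<noteq> 0\<close>.  Then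
  \<open>X\<^sub>1\<close> spans \<open>[\<hh>, \<hh>]\<close>, so \<open>f\<close> preserves its line, and the \<open>\<qq>'\<close>-component \<open>Q\<close> of the
  restriction of \<open>f\<close> to \<open>\<qq>\<close> is bijective.  Comparing \<open>[Y\<^sub>1, x]\<close> with its image shows that \<open>Q\<close>
  conjugates \<open>C\<close> to a multiple of \<open>C'\<close>; comparing \<open>[x, y]\<close> with its image gives
  \<open>B'(Q C x, Q y) = k B(C x, y)\<close>, and a square root of \<open>k\<close> scales \<open>Q\<close> so that \<open>k = 1\<close>
  (\<open>linear_part_of_preserving_iso\<close>).  If \<open>f\<close> is an isometry, so is \<open>Q\<close>.  In general,
  an arbitrary isometry \<open>A\<close> from \<open>\<qq>\<close> to \<open>\<qq>'\<close> gives \<open>P = A\<^sup>-\<^sup>1 Q\<close>: then \<open>Q P\<^sup>-\<^sup>1 = A\<close>, and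
  \<open>P\<^sup>* P C = C\<close> is a restatement of \<open>B'(Q C x, Q y) = B(C x, y)\<close>.  Such an isometry exists because
  complex quadratic spaces of equal dimension have orthonormal bases of equal length.

  What remains is the case that \<open>f\<close> does not preserve the hyperplanes, which does occur, for example
  for the nilpotent double extensions of low rank.  Let \<open>f a \<notin> \<hh>'\<close> with \<open>a \<in> \<hh>\<close>.  Since
  \<open>[a, \<hh>] \<subseteq> \<complex>X\<^sub>1\<close>, the map \<open>C'\<close> sends a hyperplane of \<open>\<qq>'\<close> into the line of the
  \<open>\<qq>'\<close>-component of \<open>f X\<^sub>1\<close>, which it annihilates as \<open>f X\<^sub>1\<close> is central.  So \<open>C' = 0\<close> or
  \<open>C' x = B'(u', x) v' - B'(v', x) u'\<close>, where moreover \<open>v'\<close> is isotropic and orthogonal to \<open>u'\<close>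
  (\<open>degenerate_if_not_preserved\<close>).  The inverse of \<open>f\<close> yields vectors \<open>u, v\<close> of the same kind for
  \<open>C\<close>.  After scaling, \<open>B(u, u)\<close> is \<open>0\<close> or \<open>1\<close>, and which of the two holds can be read off the Lie
  algebra because \<open>B(u, u) = 0\<close> means \<open>C\<^sup>2 = 0\<close>, that is, nilpotency of class at most two.  Hence
  the pairs \<open>(u, v)\<close> and \<open>(u', v')\<close> have the same Gram matrix.  Writing them in the same way in
  suitable orthonormal bases (an instance of Witt's extension theorem) produces an isometry that
  carries one pair to the other, and therefore \<open>C\<close> to \<open>C'\<close>; this satisfies the
  conclusions of both parts.
\<close>

section \<open>Orthonormal bases of complex quadratic spaces\<close>

context quadratic_space
begin

lemma form_add: "B (x + x') y = B x y + B x' y" "B x (y + y') = B x y + B x y'"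
  and form_scale: "B (scale c x) y = c * B x y" "B x (scale c y) = c * B x y"
  using form_bilinear by (simp_all add: bilinear_map_def Vector_Spaces.linear_iff)

lemma form_zero: "B 0 y = 0" "B x 0 = 0"
  using form_scale(1)[of 0 0] form_scale(2)[of x 0 0] by simp_all

lemma form_diff: "B (x - x') y = B x y - B x' y" "B x (y - y') = B x y - B x y'"
  using form_add(1)[of "x - x'" x' y] form_add(2)[of x "y - y'" y'] by (simp_all add: eq_diff_eq)

lemma form_sum: "B (sum g I) y = (\<Sum>i\<in>I. B (g i) y)" "B x (sum g I) = (\<Sum>i\<in>I. B x (g i))"
  by (induction I rule: infinite_finite_induct) (simp_all add: form_zero form_add)

lemma form_minus: "B (- x) y = - B x y" "B x (- y) = - B x y"
  using form_diff(1)[of 0 x y] form_diff(2)[of x 0 y] by (simp_all add: form_zero)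

lemmas form_simps = form_add form_scale form_zero form_diff form_minus

lemma eq_by_form: "x = y" if "\<And>z. B x z = B y z"
  using form_nondeg[of "x - y"] that by (simp add: form_diff)

definition orthonormal :: "'a list \<Rightarrow> bool" where
  "orthonormal es \<longleftrightarrow>
     (\<forall>i<length es. \<forall>j<length es. B (es ! i) (es ! j) = (if i = j then 1 else 0))"

definition orthonormal_basis :: "'a list \<Rightarrow> bool" where
  "orthonormal_basis es \<longleftrightarrow> orthonormal es \<and> (\<forall>x. (\<forall>e\<in>set es. B x e = 0) \<longrightarrow> x = 0)"

definition expansion :: "'a list \<Rightarrow> 'a \<Rightarrow> 'a" where
  "expansion es x = (\<Sum>i<length es. scale (B x (es ! i)) (es ! i))"

lemma orthonormalD:
  "orthonormal es \<Longrightarrow> i < length es \<Longrightarrow> j < length es \<Longrightarrow> B (es ! i) (es ! j) = (if i = j then 1 else 0)"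
  by (simp add: orthonormal_def)

lemma orthonormal_snoc:
  assumes "orthonormal es" "B x x = 1" "\<And>e. e \<in> set es \<Longrightarrow> B x e = 0"
  shows "orthonormal (es @ [x])"
proof -
  have "B e x = 0" if "e \<in> set es" for e
    using assms(3)[OF that] form_sym by simp
  then show ?thesis
    using assms by (auto simp: orthonormal_def nth_append less_Suc_eq)
qed

lemma form_combination:
  assumes "orthonormal es" "j < length es"
  shows "B (\<Sum>i<length es. scale (c i) (es ! i)) (es ! j) = c j"
proof -
  have "B (\<Sum>i<length es. scale (c i) (es ! i)) (es ! j) =
        (\<Sum>i<length es. if i = j then c i else 0)"
    unfolding form_sum form_scale
    by (rule sum.cong) (simp_all add: orthonormalD[OF assms(1)] assms(2))
  also have "\<dots> = c j" using assms(2) by simp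
  finally show ?thesis .
qed

lemma form_expansion:
  assumes "orthonormal es" "e \<in> set es"
  shows "B (expansion es x) e = B x e"
  using assms form_combination[OF assms(1)] by (auto simp: expansion_def in_set_conv_nth)

lemma orthogonal_to_expansion:
  "B z (expansion es x) = 0" if "\<And>e. e \<in> set es \<Longrightarrow> B z e = 0"
  using that by (simp add: expansion_def form_sum form_scale)

text \<open>The orthogonal complement of an orthonormal family is again non-degenerate, so if it is
  non-zero then the form does not vanish identically on its diagonal.\<close>

lemma exists_nonisotropic_vector:
  assumes "orthonormal es" "x \<noteq> 0" "\<And>e. e \<in> set es \<Longrightarrow> B x e = 0"
  obtains y where "B y y \<noteq> 0" "\<And>e. e \<in> set es \<Longrightarrow> B y e = 0"
proof -
  obtain y where y: "B x y \<noteq> 0" using form_nondeg assms(2) by blast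
  define z where "z = y - expansion es y"
  have z: "B z e = 0" if "e \<in> set es" for e
    using form_expansion[OF assms(1) that] by (simp add: z_def form_diff)
  have "B x z \<noteq> 0"
    using y orthogonal_to_expansion[of es x] assms(3) by (simp add: z_def form_diff)
  \<comment> \<open>By polarization the form cannot vanish at all three vectors.\<close>
  then have "B x x \<noteq> 0 \<or> B z z \<noteq> 0 \<or> B (x + z) (x + z) \<noteq> 0"
    by (auto simp: form_add form_sym[of z x])
  moreover have "B (x + z) e = 0" if "e \<in> set es" for e
    using that assms(3) z by (simp add: form_add)
  ultimately show thesis
    using that assms(3) z by blast
qed

lemma orthonormal_independent:
  assumes "orthonormal es"
  shows "independent (set es)" "distinct es"
proof -
  show d: "distinct es"
    unfolding distinct_conv_nth
  proof (intro allI impI)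
    fix i j assume "i < length es" "j < length es" "i \<noteq> j"
    then show "es ! i \<noteq> es ! j"
      using orthonormalD[OF assms, of i i] orthonormalD[OF assms, of i j] by auto
  qed
  have ortho: "B e f = (if e = f then 1 else 0)" if "e \<in> set es" "f \<in> set es" for e f
    using that orthonormalD[OF assms] d by (auto simp: in_set_conv_nth nth_eq_iff_index_eq)
  show "independent (set es)"
  proof (subst dependent_finite, simp, safe)
    fix g e assume 0: "(\<Sum>e\<in>set es. scale (g e) e) = 0" and e: "e \<in> set es" and g: "g e \<noteq> 0"
    have "0 = B (\<Sum>f\<in>set es. scale (g f) f) e" using 0 by (simp add: form_zero)
    also have "\<dots> = (\<Sum>f\<in>set es. if f = e then g f else 0)"
      unfolding form_sum form_scale by (rule sum.cong) (simp_all add: ortho e)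
    also have "\<dots> = g e" using e by simp
    finally show False using g by simp
  qed
qed

lemma orthonormal_basis_expansion:
  "expansion es x = x" if "orthonormal_basis es"
proof -
  have "B (expansion es x - x) e = 0" if "e \<in> set es" for e
    using \<open>orthonormal_basis es\<close> form_expansion[of es e x] that
    by (simp add: orthonormal_basis_def form_diff)
  then have "expansion es x - x = 0"
    using that unfolding orthonormal_basis_def by blast
  then show ?thesis by simp
qed

lemma orthonormal_basis_span:
  "span (set es) = UNIV" if "orthonormal_basis es"
proof -
  have "expansion es x \<in> span (set es)" for x
    unfolding expansion_def by (intro span_sum span_scale span_base) simp
  then show ?thesis using orthonormal_basis_expansion[OF that] by (metis UNIV_eq_I)
qed

text \<open>A unit vector orthogonal to the family is a scaled non-isotropic one.  The process ends because an
  orthonormal family is independent.\<close>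

lemma orthonormal_extend:
  assumes "orthonormal es"
  obtains fs where "orthonormal_basis (es @ fs)"
proof -
  obtain S where S: "finite S" "span S = UNIV" using finite_dim by blast
  have bound: "length ds \<le> card S" if "orthonormal ds" for ds
    using independent_span_bound[OF S(1) orthonormal_independent(1)[OF that]]
      orthonormal_independent(2)[OF that] S by (simp add: distinct_card)
  have "\<exists>fs. orthonormal_basis (es @ fs)"
    using assms
  proof (induction "card S - length es" arbitrary: es rule: less_induct)
    case less
    show ?case
    proof (cases "orthonormal_basis es")
      case True
      then show ?thesis by (metis append_Nil2)
    next
      case False
      then obtain x where x: "x \<noteq> 0" "\<And>e. e \<in> set es \<Longrightarrow> B x e = 0"
        using less.prems by (auto simp: orthonormal_basis_def)
      obtain y where y: "B y y \<noteq> 0" "\<And>e. e \<in> set es \<Longrightarrow> B y e = 0"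
        using exists_nonisotropic_vector[OF less.prems x] by blast
      define z where "z = scale (1 / csqrt (B y y)) y"
      have "B z z = 1"
        using y(1) power2_csqrt[of "B y y"]
        by (simp add: z_def form_scale divide_simps power2_eq_square)
      then have z: "orthonormal (es @ [z])"
        using y(2) by (intro orthonormal_snoc less.prems) (auto simp: z_def form_scale)
      have "card S - length (es @ [z]) < card S - length es"
        using bound[OF z] by simp
      from less.hyps[OF this z] show ?thesis by auto
    qed
  qed
  then show thesis using that by blast
qed

lemma orthonormal_basis_exists:
  obtains es where "orthonormal_basis es"
  using orthonormal_extend[of "[]"] by (auto simp: orthonormal_def)

text \<open>An isotropic vector spans a hyperbolic plane together with a correction of \<open>y\<close>; the plane has the
  orthonormal basis \<open>(v + w) / 2\<close>, \<open>(v - w) / (2\<i>)\<close>, where \<open>w\<close> is isotropic with \<open>B v w = 2\<close>.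
  The last clause says that the plane lies in the span of \<open>v\<close> and \<open>y\<close>, which lets the
  construction be repeated for further vectors orthogonal to both.\<close>

lemma hyperbolic_partner:
  assumes "orthonormal es" "B v v = 0" "\<And>e. e \<in> set es \<Longrightarrow> B v e = 0"
    and "B v y \<noteq> 0" "\<And>e. e \<in> set es \<Longrightarrow> B y e = 0"
  obtains e e' where "orthonormal (es @ [e, e'])" "v = e + scale \<i> e'"
    "\<And>z. B z v = 0 \<Longrightarrow> B z y = 0 \<Longrightarrow> B z e = 0 \<and> B z e' = 0"
proof -
  define y2 where "y2 = scale (2 / B v y) y"
  \<comment> \<open>Subtracting a multiple of \<open>v\<close> makes the partner isotropic without changing its product
    with \<open>v\<close>.\<close>
  define w where "w = y2 - scale (B y2 y2 / 4) v"
  have vy: "B v y2 = 2" "B y2 v = 2"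
    using assms(4) by (simp_all add: y2_def form_scale form_sym[of y v])
  have w: "B v w = 2" "B w v = 2" "B w w = 0"
    using vy assms(2) by (simp_all add: w_def form_diff form_scale)
  have orth: "B z w = 0" if "B z v = 0" "B z y = 0" for z
    using that by (simp add: w_def y2_def form_diff form_scale)
  have we: "B w e = 0" if "e \<in> set es" for e
    using that assms(3,5) by (simp add: w_def y2_def form_diff form_scale)
  define e where "e = scale (1/2) (v + w)"
  define e' where "e' = scale (- \<i>/2) (v - w)"
  have "B e e = 1" "B e' e' = 1" "B e' e = 0"
    using w assms(2) by (simp_all add: e_def e'_def form_simps)
  then have "orthonormal ((es @ [e]) @ [e'])"
    using assms(3) we
    by (intro orthonormal_snoc assms(1)) (auto simp: e_def e'_def form_simps w assms(2))
  moreover have "e + scale \<i> e' = v"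
  proof -
    have "e + scale \<i> e' = scale (1/2) (v + w) + scale (1/2) (v - w)"
      by (simp add: e_def e'_def)
    also have "\<dots> = scale (1/2) v + scale (1/2) v"
      by (simp add: scale_right_distrib scale_right_diff_distrib)
    also have "\<dots> = v" by (simp flip: scale_left_distrib)
    finally show ?thesis .
  qed
  moreover have "B z e = 0 \<and> B z e' = 0" if "B z v = 0" "B z y = 0" for z
    using orth[OF that] that by (simp add: e_def e'_def form_simps)
  ultimately show thesis using that[of e e'] by simp
qed

text \<open>The coordinates of \<open>v\<close> and \<open>u\<close> in the basis depend only on \<open>B u u\<close>.  This is what is needed of
  Witt's extension theorem: two such pairs with equal Gram matrices correspond under the isometry that
  matches the bases.\<close>

lemma adapted_orthonormal_basis:
  assumes "B v v = 0" "B u v = 0" "B u u = 0 \<or> B u u = 1"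
    and "u \<noteq> 0" "\<And>k. v \<noteq> scale k u"
  obtains es where "orthonormal_basis es" "1 < length es" "v = es ! 0 + scale \<i> (es ! 1)"
    "B u u = 1 \<Longrightarrow> 2 < length es \<and> u = es ! 2"
    "B u u = 0 \<Longrightarrow> 3 < length es \<and> u = es ! 2 + scale \<i> (es ! 3)"
proof -
  obtain t where t: "B u t \<noteq> 0" using form_nondeg assms(4) by blast
  have "v - scale (B v t / B u t) u \<noteq> 0" using assms(5) by simp
  then obtain z where z: "B (v - scale (B v t / B u t) u) z \<noteq> 0" using form_nondeg by blast
  \<comment> \<open>A partner for \<open>v\<close> that is orthogonal to \<open>u\<close>, so that splitting off the hyperbolic plane of
    \<open>v\<close> leaves \<open>u\<close> in the complement.\<close>
  define y where "y = z - scale (B u z / B u t) t"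
  have y: "B u y = 0" "B v y \<noteq> 0"
    using t z by (simp_all add: y_def form_diff form_scale mult.commute)
  have "orthonormal []" by (simp add: orthonormal_def)
  then obtain e e' where e: "orthonormal [e, e']" "v = e + scale \<i> e'"
    and orth: "\<And>z. B z v = 0 \<Longrightarrow> B z y = 0 \<Longrightarrow> B z e = 0 \<and> B z e' = 0"
    using hyperbolic_partner[of "[]" v y] assms(1) y(2) by auto
  have ue: "B u f = 0" if "f \<in> set [e, e']" for f
    using that orth[of u] assms(2) y(1) by auto
  show thesis
  proof (cases "B u u = 1")
    case True
    then have "orthonormal ([e, e'] @ [u])" by (intro orthonormal_snoc e ue)
    then obtain fs where "orthonormal_basis (([e, e'] @ [u]) @ fs)"
      using orthonormal_extend by blast
    then show ?thesis using True e(2) by (intro that[of "[e, e', u] @ fs"]) simp_all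
  next
    case False
    define x where "x = t - expansion [e, e'] t"
    have "B x f = 0" if "f \<in> set [e, e']" for f
      using form_expansion[OF e(1) that] by (simp add: x_def form_diff)
    moreover have "B u x \<noteq> 0"
      using orthogonal_to_expansion[of "[e, e']" u t] ue t by (simp add: x_def form_diff)
    moreover have "B u u = 0" using False assms(3) by simp
    ultimately obtain g g' where g: "orthonormal ([e, e'] @ [g, g'])" "u = g + scale \<i> g'"
      using hyperbolic_partner[of "[e, e']" u x] e(1) ue by metis
    then obtain fs where "orthonormal_basis (([e, e'] @ [g, g']) @ fs)"
      using orthonormal_extend by blast
    then show ?thesis
      using False e(2) g(2) by (intro that[of "[e, e', g, g'] @ fs"]) simp_all
  qed
qed

end

section \<open>Isometries between quadratic spaces of equal dimension\<close>

lemma linear_iso_inv: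
  assumes "linear_iso s t f"
  shows "linear_iso t s (inv f)"
proof -
  have lin: "vector_space s" "vector_space t" "f (x + y) = f x + f y" "f (s c x) = t c (f x)"
    and bij: "bij f" for x y c
    using assms by (auto simp: linear_iso_def Vector_Spaces.linear_iff)
  have inv: "inv f (f x) = x" "f (inv f y) = y" for x y
    using bij by (simp_all add: bij_is_inj bij_is_surj surj_f_inv_f)
  have "inv f (x + y) = inv f x + inv f y" "inv f (t c x) = s c (inv f x)" for x y c
    by (metis inv lin(3), metis inv lin(4))
  then show ?thesis
    using lin(1,2) bij by (simp add: linear_iso_def Vector_Spaces.linear_iff bij_imp_bij_inv)
qed

lemma lie_iso_inv:
  assumes "lie_iso s br t br' f"
  shows "lie_iso t br' s br (inv f)"
proof -
  have lin: "linear_iso s t f" and hom: "f (br x y) = br' (f x) (f y)" for x y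
    using assms by (auto simp: lie_iso_def)
  have inv: "inv f (f x) = x" "f (inv f y) = y" for x y
    using lin by (simp_all add: linear_iso_def bij_is_inj bij_is_surj surj_f_inv_f)
  show ?thesis
    unfolding lie_iso_def using linear_iso_inv[OF lin] by (metis inv hom)
qed

locale quadratic_space_pair = q: quadratic_space s B + r: quadratic_space s' B'
  for s :: "complex \<Rightarrow> 'a::ab_group_add \<Rightarrow> 'a" and B :: "'a \<Rightarrow> 'a \<Rightarrow> complex"
    and s' :: "complex \<Rightarrow> 'b::ab_group_add \<Rightarrow> 'b" and B' :: "'b \<Rightarrow> 'b \<Rightarrow> complex"
begin

text \<open>Dimensions are compared through orthonormal bases: the image of one basis is independent in the
  span of the other.\<close>

lemma orthonormal_basis_length_le:
  assumes "linear_iso s s' f" "q.orthonormal_basis es" "r.orthonormal_basis es'"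
  shows "length es \<le> length es'"
proof -
  interpret vector_space_pair s s' by unfold_locales
  have f: "Vector_Spaces.linear s s' f" "inj f"
    using assms(1) by (auto simp: linear_iso_def bij_is_inj)
  have es: "q.independent (set es)" "distinct es" "distinct es'"
    using assms q.orthonormal_independent r.orthonormal_independent
    by (auto simp: q.orthonormal_basis_def r.orthonormal_basis_def)
  have "r.independent (f ` set es)"
    using linear_independent_injective_image[OF f(1) es(1)] f(2) by (simp add: inj_on_subset)
  then have "card (f ` set es) \<le> card (set es')"
    using r.independent_span_bound[of "set es'" "f ` set es"] r.orthonormal_basis_span[OF assms(3)]
    by simp
  then show ?thesis
    using f(2) es by (simp add: card_image inj_on_subset distinct_card)
qed

lemma isometry_between_orthonormal_bases:
  assumes "q.orthonormal_basis es" "r.orthonormal_basis es'" "length es = length es'"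
  obtains A where "isometry s B s' B' A" "\<And>i. i < length es \<Longrightarrow> A (es ! i) = es' ! i"
proof -
  define A where "A x = (\<Sum>i<length es'. s' (B x (es ! i)) (es' ! i))" for x
  have on: "q.orthonormal es" "r.orthonormal es'"
    using assms by (auto simp: q.orthonormal_basis_def r.orthonormal_basis_def)
  have Ae: "B' (A x) (es' ! j) = B x (es ! j)" if "j < length es'" for x j
    unfolding A_def using r.form_combination[OF on(2) that] .
  have isom: "B' (A x) (A y) = B x y" for x y
  proof -
    have "B' (A x) (A y) = (\<Sum>i<length es'. B y (es ! i) * B' (A x) (es' ! i))"
      by (subst (2) A_def) (simp add: r.form_sum r.form_scale)
    also have "\<dots> = B x (q.expansion es y)"
      by (simp add: q.expansion_def q.form_sum q.form_scale Ae assms(3))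
    also have "\<dots> = B x y" by (simp add: q.orthonormal_basis_expansion[OF assms(1)])
    finally show ?thesis .
  qed
  have lin: "Vector_Spaces.linear s s' A"
    unfolding Vector_Spaces.linear_iff A_def
    using q.vector_space_axioms r.vector_space_axioms
    by (simp add: q.form_simps r.scale_left_distrib sum.distrib r.scale_sum_right)
  have "inj A"
    by (rule injI) (metis isom q.eq_by_form)
  moreover have "surj A"
  proof (rule surjI)
    fix z
    define y where "y = (\<Sum>i<length es. s (B' z (es' ! i)) (es ! i))"
    have "B' (A y - z) e = 0" if e: "e \<in> set es'" for e
    proof -
      obtain j where "j < length es'" "e = es' ! j" using e by (metis in_set_conv_nth)
      then show ?thesis
        using Ae[of j y] q.form_combination[OF on(1), of j] assms(3)
        by (simp add: y_def r.form_diff)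
    qed
    then have "A y - z = 0" using assms(2) unfolding r.orthonormal_basis_def by blast
    then show "A (\<Sum>i<length es. s (B' z (es' ! i)) (es ! i)) = z" by (simp add: y_def)
  qed
  ultimately have "isometry s B s' B' A"
    using lin isom by (simp add: isometry_def linear_iso_def bij_def)
  moreover have "A (es ! i) = es' ! i" if "i < length es" for i
  proof -
    have "A (es ! i) = (\<Sum>j<length es'. if j = i then es' ! j else 0)"
      unfolding A_def
    proof (rule sum.cong)
      fix j assume "j \<in> {..<length es'}"
      then have "B (es ! i) (es ! j) = (if i = j then 1 else 0)"
        using q.orthonormalD[OF on(1), of i j] that assms(3) by simp
      then show "s' (B (es ! i) (es ! j)) (es' ! j) = (if j = i then es' ! j else 0)" by simp
    qed simp
    also have "\<dots> = es' ! i" using that assms(3) by simp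
    finally show ?thesis .
  qed
  ultimately show thesis using that by blast
qed

end

section \<open>Skew-symmetric maps of rank two\<close>

locale skew_map = quadratic_space scale B
  for scale :: "complex \<Rightarrow> 'a::ab_group_add \<Rightarrow> 'a" and B :: "'a \<Rightarrow> 'a \<Rightarrow> complex" +
  fixes C :: "'a \<Rightarrow> 'a"
  assumes skew_symmetric: "skew_symmetric_map scale B C"
begin

lemma C_add: "C (x + y) = C x + C y" and C_scale: "C (scale c x) = scale c (C x)"
  and skew: "B (C x) y = - B x (C y)"
  using skew_symmetric by (auto simp: skew_symmetric_map_def Vector_Spaces.linear_iff)

lemma C_diff: "C (x - y) = C x - C y"
  using C_add[of "x - y" y] by simp

lemma C_zero: "C 0 = 0"
  using C_diff[of 0 0] by simp

lemma skew_diag: "B (C x) x = 0" "B x (C x) = 0"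
  using skew[of x x] form_sym[of x "C x"] by simp_all

definition wedge :: "'a \<Rightarrow> 'a \<Rightarrow> 'a \<Rightarrow> 'a" where
  "wedge u v x = scale (B u x) v - scale (B v x) u"

text \<open>The plane spanned by \<open>u\<close> and \<open>v\<close> is the image of \<open>C\<close>; it is degenerate, with \<open>v\<close> in its radical.
  Over the complex numbers \<open>u\<close> can be normalized.\<close>

definition degenerate_rank_two :: "'a \<Rightarrow> 'a \<Rightarrow> bool" where
  "degenerate_rank_two u v \<longleftrightarrow> C = wedge u v \<and> B v v = 0 \<and> B u v = 0 \<and>
     (B u u = 0 \<or> B u u = 1) \<and> u \<noteq> 0 \<and> (\<forall>k. v \<noteq> scale k u)"

text \<open>A skew-symmetric map of rank at most one vanishes.\<close>

lemma zero_if_zero_on_kernel: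
  fixes \<psi> :: "'a \<Rightarrow> complex"
  assumes lin: "\<And>x y. \<psi> (x + y) = \<psi> x + \<psi> y" "\<And>c x. \<psi> (scale c x) = c * \<psi> x"
    and ker: "\<And>w. \<psi> w = 0 \<Longrightarrow> C w = 0"
  shows "C x = 0"
proof (cases "\<psi> x = 0")
  case False
  have C: "C y = scale (\<psi> y / \<psi> x) (C x)" for y
  proof -
    have "\<psi> (y - scale (\<psi> y / \<psi> x) x + scale (\<psi> y / \<psi> x) x) =
          \<psi> (y - scale (\<psi> y / \<psi> x) x) + \<psi> (scale (\<psi> y / \<psi> x) x)" by (rule lin)
    then have "\<psi> (y - scale (\<psi> y / \<psi> x) x) = 0" using False by (simp add: lin)
    from ker[OF this] show ?thesis by (simp add: C_diff C_scale)
  qed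
  have "B (C x) y = 0" for y
    unfolding skew C[of y] by (simp add: form_simps skew_diag)
  then show ?thesis by (rule form_nondeg)
qed (rule ker)

text \<open>For \<open>w\<close> in the kernel of \<open>\<psi>\<close>, skew-symmetry gives \<open>B (C w) w = 0\<close>, so \<open>C w = 0\<close> or
  \<open>B p w = 0\<close>.  A vector space is not the union of two proper subspaces and \<open>C\<close> is not zero on the
  kernel, so \<open>p\<close> is orthogonal to the whole kernel and \<open>\<psi>\<close> is a multiple of \<open>B p\<close>.
  With \<open>B p t = 1\<close>, skew-symmetry then forces \<open>C = wedge u p\<close> for \<open>u = - C t\<close>, and \<open>C p = 0\<close> makes
  \<open>p\<close> isotropic.\<close>

lemma degenerate_rank_two_exists:
  fixes \<psi> :: "'a \<Rightarrow> complex"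
  assumes "C \<noteq> (\<lambda>_. 0)"
    and lin: "\<And>x y. \<psi> (x + y) = \<psi> x + \<psi> y" "\<And>c x. \<psi> (scale c x) = c * \<psi> x"
    and ker: "\<And>w. \<psi> w = 0 \<Longrightarrow> \<exists>k. C w = scale k p"
    and p: "C p = 0"
  shows "\<exists>u v. degenerate_rank_two u v"
proof -
  have nz: "\<exists>w. \<psi> w = 0 \<and> C w \<noteq> 0"
    using zero_if_zero_on_kernel[of \<psi>, OF lin] assms(1) by blast
  then have p0: "p \<noteq> 0" using ker by fastforce
  have alt: "C w = 0 \<or> B p w = 0" if "\<psi> w = 0" for w
    using ker[OF that] skew_diag(1)[of w] by (auto simp: form_scale)
  have perp: "B p w = 0" if "\<psi> w = 0" for w
  proof (rule ccontr)
    assume w: "B p w \<noteq> 0"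
    obtain x where x: "\<psi> x = 0" "C x \<noteq> 0" using nz by blast
    have "\<psi> (w + x) = 0" using that x by (simp add: lin)
    from alt[OF this] alt[OF that] alt[OF x(1)] w x show False
      by (simp add: C_add form_add)
  qed
  obtain t0 where "B p t0 \<noteq> 0" using p0 form_nondeg by blast
  then obtain t where t: "B p t = 1"
    using form_scale(2)[of p "1 / B p t0" t0] by auto
  have "\<psi> t \<noteq> 0" using perp[of t] t by auto
  have im: "\<exists>k. C w = scale k p" if "B p w = 0" for w
  proof (rule ker)
    have "\<psi> (w + scale (- \<psi> w / \<psi> t) t) = 0" unfolding lin using \<open>\<psi> t \<noteq> 0\<close> by simp
    from perp[OF this] show "\<psi> w = 0" using that t \<open>\<psi> t \<noteq> 0\<close> by (simp add: form_simps)
  qed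
  define u where "u = - C t"
  have ut: "B u t = 0" and up: "B u p = 0"
    using skew[of t p] p by (simp_all add: u_def form_minus skew_diag form_zero)
  have C: "C = wedge u p"
  proof
    fix x
    have "B p (x - scale (B p x) t) = 0" using t by (simp add: form_simps)
    from im[OF this] obtain k where k: "C x + scale (B p x) u = scale k p"
      by (auto simp: C_diff C_scale u_def)
    have "k = B (scale k p) t" using t by (simp add: form_scale)
    also have "\<dots> = B (C x) t" by (simp flip: k add: form_simps ut)
    also have "\<dots> = B u x" using form_sym[of x "C t"] by (simp add: skew u_def form_minus)
    finally show "C x = wedge u p x" using k by (simp add: wedge_def eq_diff_eq)
  qed
  have ind: "u \<noteq> scale k p" for k
  proof
    assume "u = scale k p"
    then have "wedge u p x = 0" for x by (simp add: wedge_def form_scale mult.commute)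
    then show False using assms(1) C by blast
  qed
  have u0: "u \<noteq> 0" using ind[of 0] by simp
  have "scale (B p p) u = 0" using p up unfolding C by (simp add: wedge_def)
  then have pp: "B p p = 0" using u0 by simp
  show ?thesis
  proof (cases "B u u = 0")
    case True
    have "p \<noteq> scale k u" for k
    proof
      assume "p = scale k u"
      then have "u = scale (1 / k) p" using p0 by auto
      then show False using ind by blast
    qed
    then show ?thesis
      using C pp up u0 True unfolding degenerate_rank_two_def by blast
  next
    case False
    \<comment> \<open>\<open>wedge\<close> is unchanged when \<open>u\<close> is divided and \<open>p\<close> multiplied by the same scalar.\<close>
    define r where "r = csqrt (B u u)"
    have r: "r \<noteq> 0" "r * r = B u u"
      using False power2_csqrt[of "B u u"] by (auto simp: r_def power2_eq_square)
    have "scale r p \<noteq> scale k (scale (1 / r) u)" for k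
    proof
      assume eq: "scale r p = scale k (scale (1 / r) u)"
      then have "k \<noteq> 0" using p0 r by auto
      then have "u = scale (r / k) (scale k (scale (1 / r) u))" using r(1) by simp
      also have "\<dots> = scale (r / k * r) p" by (subst eq[symmetric]) simp
      finally show False using ind by blast
    qed
    moreover have "C = wedge (scale (1 / r) u) (scale r p)"
      using r by (simp add: C wedge_def fun_eq_iff form_scale)
    moreover have "B (scale (1 / r) u) (scale (1 / r) u) = 1"
      using r by (simp add: form_scale flip: r(2))
    ultimately show ?thesis
      using pp up u0 r unfolding degenerate_rank_two_def
      by (intro exI[of _ "scale (1 / r) u"] exI[of _ "scale r p"]) (simp add: form_scale)
  qed
qed

lemma degenerate_rank_two_square:
  assumes "degenerate_rank_two u v"
  shows "(\<forall>x. C (C x) = 0) \<longleftrightarrow> B u u = 0"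
proof -
  have a: "C = wedge u v" "B v v = 0" "B u v = 0" "v \<noteq> 0"
    using assms unfolding degenerate_rank_two_def by (metis scale_zero_left)+
  have "C v = 0" "C u = scale (B u u) v"
    using a form_sym[of u v] by (simp_all add: wedge_def)
  then have CC: "C (C x) = scale (- (B v x * B u u)) v" for x
    unfolding a(1)[THEN fun_cong, of x] by (simp add: wedge_def C_diff C_scale)
  obtain x where "B v x \<noteq> 0" using a(4) form_nondeg by blast
  then show ?thesis using a(4) by (auto simp: CC)
qed

end

section \<open>Isomorphisms of double extensions\<close>

lemma dext_cases:
  fixes y :: "'c dext"
  obtains l m x where "y = ((l, m), x)"
  by (metis surj_pair)

locale double_extension_pair = q: skew_map s B C + r: skew_map s' B' C'
  for s :: "complex \<Rightarrow> 'a::ab_group_add \<Rightarrow> 'a" and B C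
    and s' :: "complex \<Rightarrow> 'b::ab_group_add \<Rightarrow> 'b" and B' C'
begin

sublocale quadratic_space_pair s B s' B' ..

abbreviation g_iso :: "('a dext \<Rightarrow> 'b dext) \<Rightarrow> bool" where
  "g_iso \<equiv> lie_iso (dext_scale s) (dext_bracket s B C) (dext_scale s') (dext_bracket s' B' C')"

lemma swapped: "double_extension_pair s' B' C' s B C" ..

lemma g_isoD:
  assumes "g_iso f"
  shows "f (x + y) = f x + f y" "f (dext_scale s c x) = dext_scale s' c (f x)"
    "f (dext_bracket s B C x y) = dext_bracket s' B' C' (f x) (f y)"
    "inv f (f x) = x" "f (inv f z) = z" "f 0 = 0"
proof -
  have lin: "\<forall>x y. f (x + y) = f x + f y" "\<forall>c x. f (dext_scale s c x) = dext_scale s' c (f x)"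
    and hom: "\<forall>x y. f (dext_bracket s B C x y) = dext_bracket s' B' C' (f x) (f y)"
    and bij: "bij f"
    using assms unfolding lie_iso_def linear_iso_def Vector_Spaces.linear_iff by blast+
  show "f (x + y) = f x + f y" "f (dext_scale s c x) = dext_scale s' c (f x)"
    "f (dext_bracket s B C x y) = dext_bracket s' B' C' (f x) (f y)"
    using lin hom by blast+
  show "inv f (f x) = x" "f (inv f z) = z"
    using bij by (simp_all add: bij_is_inj bij_is_surj surj_f_inv_f)
  have "f (0 + 0) = f 0 + f 0" using lin(1) by blast
  then show "f 0 = 0" by simp
qed

lemma conjugate_iff:
  assumes "linear_iso s s' Q"
  shows "C' = (\<lambda>x. s' c (Q (C (inv Q x)))) \<longleftrightarrow> (\<forall>x. C' (Q x) = s' c (Q (C x)))"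
proof -
  have "inv Q (Q x) = x" "Q (inv Q y) = y" for x y
    using assms by (simp_all add: linear_iso_def bij_is_inj bij_is_surj surj_f_inv_f)
  then show ?thesis by (metis ext)
qed

text \<open>Orthonormal vectors \<open>X\<^sub>1 + Y\<^sub>1 / 2\<close> and \<open>\<i> (X\<^sub>1 - Y\<^sub>1 / 2)\<close> of the hyperbolic plane are
  prepended, so an isomorphism of double extensions forces the underlying spaces to have equal dimension even when it does
  not map one to the other.\<close>

lemma orthonormal_basis_dext:
  assumes "q.orthonormal_basis es"
  shows "quadratic_space.orthonormal_basis (dext_form B)
           ([((1, 1/2), 0), ((\<i>, - \<i>/2), 0)] @ map (Pair (0, 0)) es)"
proof -
  interpret g: quadratic_lie_algebra "dext_scale s" "dext_form B" "dext_bracket s B C"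
    by (rule double_extension_quadratic_lie_algebra[OF q.quadratic_space_axioms q.skew_symmetric])
  show ?thesis
    unfolding g.orthonormal_basis_def
  proof safe
    show "g.orthonormal ([((1, 1/2), 0), ((\<i>, - \<i>/2), 0)] @ map (Pair (0, 0)) es)"
      using assms unfolding q.orthonormal_basis_def q.orthonormal_def g.orthonormal_def
      by (auto simp: nth_Cons q.form_zero split: nat.split)
    fix l m x
    assume orth: "\<forall>e\<in>set ([((1, 1/2), 0), ((\<i>, - \<i>/2), 0)] @ map (Pair (0, 0)) es).
      dext_form B ((l, m), x) e = 0"
    then have "x = 0" using assms by (auto simp: q.orthonormal_basis_def)
    moreover have "l / 2 + m = 0" "\<i> * (m - l / 2) = 0"
      using orth by (simp_all add: q.form_zero algebra_simps)
    then have "l / 2 + m = 0" "m - l / 2 = 0" by simp_all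
    then have "l = 0 \<and> m = 0" by (auto simp: algebra_simps)
    ultimately show "((l, m), x) = 0" by (simp add: zero_prod_def)
  qed
qed

lemma orthonormal_basis_length_le_of_lie_iso:
  assumes "g_iso f" "q.orthonormal_basis es" "r.orthonormal_basis es'"
  shows "length es \<le> length es'"
proof -
  interpret sw: double_extension_pair s' B' C' s B C by (rule swapped)
  interpret gg: quadratic_space_pair "dext_scale s" "dext_form B" "dext_scale s'" "dext_form B'"
    by (rule quadratic_space_pair.intro[OF
          quadratic_lie_algebra.axioms(1)[OF double_extension_quadratic_lie_algebra[OF
              q.quadratic_space_axioms q.skew_symmetric]]
          quadratic_lie_algebra.axioms(1)[OF double_extension_quadratic_lie_algebra[OF
              r.quadratic_space_axioms r.skew_symmetric]]])
  show ?thesis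
    using gg.orthonormal_basis_length_le[OF _ orthonormal_basis_dext[OF assms(2)]
        sw.orthonormal_basis_dext[OF assms(3)]] assms(1)
    by (auto simp: lie_iso_def)
qed

lemma orthonormal_basis_length_eq_of_lie_iso:
  assumes "g_iso f" "q.orthonormal_basis es" "r.orthonormal_basis es'"
  shows "length es = length es'"
proof -
  interpret sw: double_extension_pair s' B' C' s B C by (rule swapped)
  show ?thesis
    using orthonormal_basis_length_le_of_lie_iso[OF assms]
      sw.orthonormal_basis_length_le_of_lie_iso[OF lie_iso_inv[OF assms(1)] assms(3,2)] by simp
qed

lemma isometry_exists:
  assumes "g_iso f"
  obtains A where "isometry s B s' B' A"
proof -
  obtain es es' where "q.orthonormal_basis es" "r.orthonormal_basis es'"
    using q.orthonormal_basis_exists r.orthonormal_basis_exists by metis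
  then show thesis
    using isometry_between_orthonormal_bases orthonormal_basis_length_eq_of_lie_iso[OF assms] that by metis
qed

text \<open>The double extension is abelian precisely when \<open>C = 0\<close>.\<close>

lemma zero_transfer:
  assumes "g_iso f" "\<And>x. C x = 0"
  shows "C' y = 0"
proof -
  note f = g_isoD[OF assms(1)]
  have "dext_bracket s B C a b = 0" for a b
    by (cases a rule: dext_cases; cases b rule: dext_cases) 
      (simp add: assms(2) q.form_zero zero_prod_def)
  then have "dext_bracket s' B' C' a b = 0" for a b
    using f(3)[of "inv f a" "inv f b"] by (simp add: f)
  from this[of "((0, 1), 0)" "((0, 0), y)"] show ?thesis
    by (simp add: r.C_zero zero_prod_def)
qed

text \<open>The double extension is nilpotent of class at most two precisely when \<open>C\<^sup>2 = 0\<close>.\<close>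

lemma square_zero_transfer:
  assumes "g_iso f" "\<And>x. C (C x) = 0"
  shows "C' (C' y) = 0"
proof -
  note f = g_isoD[OF assms(1)]
  have BC: "B (C x) (C y) = 0" for x y
    by (simp add: q.skew assms(2) q.form_zero)
  have "dext_bracket s B C a (dext_bracket s B C b c) = 0" for a b c
    by (cases a rule: dext_cases; cases b rule: dext_cases; cases c rule: dext_cases)
      (simp add: assms(2) BC q.form_simps q.C_diff q.C_scale zero_prod_def)
  then have "dext_bracket s' B' C' a (dext_bracket s' B' C' b c) = 0" for a b c
    using f(3)[of "inv f a" "dext_bracket s B C (inv f b) (inv f c)"]
      f(3)[of "inv f b" "inv f c"] by (simp add: f)
  from this[of "((0, 1), 0)" "((0, 1), 0)" "((0, 0), y)"] show ?thesis
    by (simp add: r.C_zero zero_prod_def)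
qed

text \<open>The bracket of \<open>a\<close> with any element of the hyperplane is a multiple of \<open>X\<^sub>1\<close>.  Applying \<open>f\<close>, the
  bracket of \<open>f a\<close> with \<open>((l, 0), w)\<close> is a multiple of the central element \<open>f X\<^sub>1\<close> whenever the
  preimage of \<open>((l, 0), w)\<close> lies in the hyperplane.  The \<open>Y\<^sub>1\<close>-coordinate of \<open>f a\<close> is non-zero, so
  this says that \<open>C' w\<close> is a multiple of the \<open>\<qq>'\<close>-component \<open>p\<close> of \<open>f X\<^sub>1\<close>.\<close>

lemma degenerate_if_not_preserved:
  assumes "g_iso f" "C' \<noteq> (\<lambda>_. 0)"
    and a: "snd (fst a) = 0" "snd (fst (f a)) \<noteq> 0"
  shows "\<exists>u v. r.degenerate_rank_two u v"
proof -
  note f = g_isoD[OF assms(1)]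
  interpret sw: double_extension_pair s' B' C' s B C by (rule swapped)
  note g = sw.g_isoD[OF lie_iso_inv[OF assms(1)]]
  obtain r0 m0 p where X: "f ((1, 0), 0) = ((r0, m0), p)" by (metis surj_pair)
  obtain l1 m1 z where fa: "f a = ((l1, m1), z)" by (metis surj_pair)
  have m1: "m1 \<noteq> 0" using a fa by simp
  have p: "C' p = 0"
  proof -
    have "dext_bracket s B C ((1, 0), 0) b = 0" for b
      by (cases b rule: dext_cases) (simp add: q.C_zero q.form_zero zero_prod_def)
    then have "dext_bracket s' B' C' ((r0, m0), p) ((0, 1), 0) = 0"
      using f(3)[of "((1, 0), 0)" "inv f ((0, 1), 0)"] by (simp add: f X)
    then show ?thesis by (simp add: r.C_zero zero_prod_def)
  qed
  define \<psi>0 where "\<psi>0 y = snd (fst (inv f y))" for y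
  have lin: "\<psi>0 (x + y) = \<psi>0 x + \<psi>0 y" "\<psi>0 (dext_scale s' c x) = c * \<psi>0 x" for x y c
    unfolding \<psi>0_def g(1,2)
    by simp (cases "inv f x" rule: dext_cases, simp)
  have im: "\<exists>k. C' w = s' k p" if ker: "\<psi>0 ((l, 0), w) = 0" for l w
  proof -
    obtain lb b where b: "inv f ((l, 0), w) = ((lb, 0), b)"
      using ker unfolding \<psi>0_def by (metis prod.collapse)
    obtain la c where a': "a = ((la, 0), c)" using a(1) by (metis prod.collapse)
    have "dext_bracket s B C a ((lb, 0), b) = dext_scale s (B (C c) b) ((1, 0), 0)"
      by (simp add: a')
    then have "dext_bracket s' B' C' (f a) ((l, 0), w) = dext_scale s' (B (C c) b) ((r0, m0), p)"
      using f(2)[of "B (C c) b" "((1, 0), 0)"] f(3)[of a "((lb, 0), b)"] f(5)[of "((l, 0), w)"]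
      by (simp add: X b)
    then have eq: "s' m1 (C' w) = s' (B (C c) b) p" by (simp add: fa)
    have "C' w = s' (1 / m1) (s' m1 (C' w))" using m1 by simp
    also have "\<dots> = s' (B (C c) b / m1) p" by (simp add: eq)
    finally show ?thesis by blast
  qed
  \<comment> \<open>If \<open>\<psi>0\<close> vanishes at \<open>X\<^sub>1'\<close>, the condition on \<open>((l, 0), w)\<close> is a linear condition on \<open>w\<close>
    alone; otherwise every \<open>w\<close> satisfies it for some \<open>l\<close>.\<close>
  show ?thesis
  proof (cases "\<psi>0 ((1, 0), 0) = 0")
    case True
    show ?thesis
    proof (rule r.degenerate_rank_two_exists[where \<psi> = "\<lambda>w. \<psi>0 ((0, 0), w)" and p = p])
      show "\<psi>0 ((0, 0), x + y) = \<psi>0 ((0, 0), x) + \<psi>0 ((0, 0), y)" for x y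
        using lin(1)[of "((0, 0), x)" "((0, 0), y)"] by simp
      show "\<psi>0 ((0, 0), s' c x) = c * \<psi>0 ((0, 0), x)" for c x
        using lin(2)[of c "((0, 0), x)"] by simp
    qed (use assms(2) im p in auto)
  next
    case False
    have "\<exists>k. C' w = s' k p" for w
    proof (rule im)
      let ?c = "- (\<psi>0 ((0, 0), w) / \<psi>0 ((1, 0), 0))"
      have "\<psi>0 (dext_scale s' ?c ((1, 0), 0) + ((0, 0), w)) = 0"
        unfolding lin using False by simp
      then show "\<psi>0 ((?c, 0), w) = 0" by simp
    qed
    then show ?thesis
      using assms(2) p by (intro r.degenerate_rank_two_exists[where \<psi> = "\<lambda>_. 0" and p = p]) auto
  qed
qed

lemma isometry_if_degenerate:
  assumes "q.degenerate_rank_two u v" "r.degenerate_rank_two u' v'" "B u u = B' u' u'"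
    and len: "\<And>es es'. q.orthonormal_basis es \<Longrightarrow> r.orthonormal_basis es' \<Longrightarrow> length es = length es'"
  shows "\<exists>A. isometry s B s' B' A \<and> (\<forall>x. C' (A x) = s' 1 (A (C x)))"
proof -
  have uv: "C = q.wedge u v" "B v v = 0" "B u v = 0" "B u u = 0 \<or> B u u = 1" "u \<noteq> 0"
      "\<And>k. v \<noteq> s k u"
    using assms(1) unfolding q.degenerate_rank_two_def by blast+
  have uv': "C' = r.wedge u' v'" "B' v' v' = 0" "B' u' v' = 0" "B' u' u' = 0 \<or> B' u' u' = 1"
      "u' \<noteq> 0" "\<And>k. v' \<noteq> s' k u'"
    using assms(2) unfolding r.degenerate_rank_two_def by blast+
  obtain es where es: "q.orthonormal_basis es" "1 < length es" "v = es ! 0 + s \<i> (es ! 1)"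
    "B u u = 1 \<Longrightarrow> 2 < length es \<and> u = es ! 2"
    "B u u = 0 \<Longrightarrow> 3 < length es \<and> u = es ! 2 + s \<i> (es ! 3)"
    using q.adapted_orthonormal_basis[OF uv(2-6)] by blast
  obtain es' where es': "r.orthonormal_basis es'" "v' = es' ! 0 + s' \<i> (es' ! 1)"
    "B' u' u' = 1 \<Longrightarrow> u' = es' ! 2" "B' u' u' = 0 \<Longrightarrow> u' = es' ! 2 + s' \<i> (es' ! 3)"
    using r.adapted_orthonormal_basis[OF uv'(2-6)] by metis
  obtain A where A: "isometry s B s' B' A" "\<And>i. i < length es \<Longrightarrow> A (es ! i) = es' ! i"
    using isometry_between_orthonormal_bases[OF es(1) es'(1) len[OF es(1) es'(1)]] by blast
  have lin: "A (x + y) = A x + A y" "A (s c x) = s' c (A x)" and isom: "B' (A x) (A y) = B x y"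
    for x y c
    using A(1) by (auto simp: isometry_def linear_iso_def Vector_Spaces.linear_iff)
  have diff: "A (x - y) = A x - A y" for x y using lin(1)[of "x - y" y] by simp
  have Av: "A v = v'" using es(2) A(2)[of 0] A(2)[of 1] by (cases es) (auto simp: es(3) es'(2) lin)
  have Au: "A u = u'"
  proof (cases "B u u = 1")
    case True
    then show ?thesis using es(4) es'(3) A(2)[of 2] assms(3) by simp
  next
    case False
    then have "B u u = 0" using uv(4) by simp
    then have "3 < length es" "u = es ! 2 + s \<i> (es ! 3)" "u' = es' ! 2 + s' \<i> (es' ! 3)"
      using es(5) es'(4) assms(3) by simp_all
    then show ?thesis using A(2)[of 2] A(2)[of 3] by (simp add: lin)
  qed
  have "C' (A x) = s' 1 (A (C x))" for x
    by (simp add: uv(1) uv'(1) q.wedge_def r.wedge_def diff lin isom flip: Au Av)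
  then show ?thesis using A(1) by blast
qed

text \<open>Both alternatives serve both parts of the theorem.  The first covers \<open>C = 0\<close>, where any isometry
  will do, and the isomorphisms that move the hyperplane.  The factor \<open>s' 1\<close> gives the conjugacy the shape
  used for general factors.\<close>

lemma isometry_or_preserved:
  assumes "g_iso f"
  shows "(\<exists>A. isometry s B s' B' A \<and> (\<forall>x. C' (A x) = s' 1 (A (C x)))) \<or>
    (C \<noteq> (\<lambda>_. 0) \<and> (\<forall>a. snd (fst a) = 0 \<longrightarrow> snd (fst (f a)) = 0))"
proof (cases "C = (\<lambda>_. 0)")
  case True
  have "C' y = 0" for y using zero_transfer[OF assms] True by simp
  moreover obtain A where A: "isometry s B s' B' A" using isometry_exists[OF assms] .
  moreover have "A 0 = 0"
  proof -
    have "A (0 + 0) = A 0 + A 0"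
      using A unfolding isometry_def linear_iso_def Vector_Spaces.linear_iff by blast
    then show ?thesis by simp
  qed
  ultimately show ?thesis using True by auto
next
  case C: False
  interpret sw: double_extension_pair s' B' C' s B C by (rule swapped)
  note f' = lie_iso_inv[OF assms]
  note f = g_isoD[OF assms] and g = sw.g_isoD[OF f']
  have C': "C' \<noteq> (\<lambda>_. 0)" using sw.zero_transfer[OF f'] C by blast
  show ?thesis
  proof (cases "\<forall>a. snd (fst a) = 0 \<longrightarrow> snd (fst (f a)) = 0")
    case False
    then obtain a where a: "snd (fst a) = 0" "snd (fst (f a)) \<noteq> 0" by blast
    \<comment> \<open>Otherwise subtracting a multiple of \<open>f a\<close> from \<open>f Y\<^sub>1\<close> would put \<open>Y\<^sub>1\<close> into the
      hyperplane.\<close>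
    have "\<exists>b. snd (fst b) = 0 \<and> snd (fst (inv f b)) \<noteq> 0"
    proof (rule ccontr)
      assume none: "\<nexists>b. snd (fst b) = 0 \<and> snd (fst (inv f b)) \<noteq> 0"
      let ?y = "f ((0, 1), 0)"
      let ?c = "- (snd (fst ?y) / snd (fst (f a)))"
      have snd_scale: "snd (fst (dext_scale t c x)) = c * snd (fst x)" for t c and x :: "'c dext"
        by (cases x rule: dext_cases) simp
      have "snd (fst (?y + dext_scale s' ?c (f a))) = 0"
        using a(2) by (simp add: snd_scale)
      then have "snd (fst (inv f (?y + dext_scale s' ?c (f a)))) = 0" using none by blast
      then show False using a(1) by (simp add: g(1,2) f(4) snd_scale)
    qed
    then obtain u v u' v' where uv: "q.degenerate_rank_two u v" "r.degenerate_rank_two u' v'"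
      using degenerate_if_not_preserved[OF assms C' a] sw.degenerate_if_not_preserved[OF f' C] by blast
    have "(\<forall>x. C (C x) = 0) \<longleftrightarrow> (\<forall>x. C' (C' x) = 0)"
      using square_zero_transfer[OF assms] sw.square_zero_transfer[OF f'] by blast
    then have "B u u = B' u' u'"
      using q.degenerate_rank_two_square[OF uv(1)] r.degenerate_rank_two_square[OF uv(2)] uv
      unfolding q.degenerate_rank_two_def r.degenerate_rank_two_def by metis
    then show ?thesis
      using isometry_if_degenerate[OF uv] orthonormal_basis_length_eq_of_lie_iso[OF assms] by blast
  qed (use C in blast)
qed

text \<open>\<open>Q\<close> is the \<open>\<qq>'\<close>-component of \<open>f\<close> on \<open>\<qq>\<close>.  The scalars come from \<open>f X\<^sub>1 = a X\<^sub>1'\<close> and from the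
  \<open>Y\<^sub>1\<close>-coordinate \<open>m\<close> of \<open>f Y\<^sub>1\<close>: \<open>c = 1 / m\<close> and \<open>k = a m\<close>.  The last clause is what makes \<open>Q\<close>
  isometric when \<open>f\<close> is.\<close>

lemma linear_part_of_preserving_iso:
  assumes "g_iso f" "C \<noteq> (\<lambda>_. 0)" "\<And>a. snd (fst a) = 0 \<Longrightarrow> snd (fst (f a)) = 0"
  obtains Q c k where "linear_iso s s' Q" "c \<noteq> 0" "k \<noteq> 0"
    "\<And>x. C' (Q x) = s' c (Q (C x))" "\<And>x y. B' (Q (C x)) (Q y) = k * B (C x) y"
    "\<And>x y. dext_form B' (f ((0, 0), x)) (f ((0, 0), y)) = B' (Q x) (Q y)"
proof -
  note f = g_isoD[OF assms(1)]
  define Q where "Q x = snd (f ((0, 0), x))" for x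
  define \<phi> where "\<phi> x = fst (fst (f ((0, 0), x)))" for x
  have fx: "f ((0, 0), x) = ((\<phi> x, 0), Q x)" for x
    using assms(3)[of "((0, 0), x)"] by (simp add: Q_def \<phi>_def prod_eq_iff)
  have inj: "x = y" if "f x = f y" for x y using f(4) that by metis
  have Q_add: "Q (x + y) = Q x + Q y" for x y
    using f(1)[of "((0, 0), x)" "((0, 0), y)"] by (simp add: fx)
  have Q_scale: "Q (s c x) = s' c (Q x)" for c x
    using f(2)[of c "((0, 0), x)"] by (simp add: fx)
  \<comment> \<open>Since \<open>C\<close> is non-zero, \<open>X\<^sub>1\<close> is a multiple of a bracket of two elements of \<open>\<qq>\<close>; this is why
    its image is a multiple of \<open>X\<^sub>1'\<close>.\<close>
  obtain x0 where "C x0 \<noteq> 0" using assms(2) by blast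
  then obtain y0 where xy0: "B (C x0) y0 \<noteq> 0" using q.form_nondeg by blast
  define a where "a = B' (C' (Q x0)) (Q y0) / B (C x0) y0"
  have fX: "f ((l, 0), 0) = ((l * a, 0), 0)" for l
  proof -
    have "((l, 0), 0) = dext_scale s (l / B (C x0) y0) (dext_bracket s B C ((0, 0), x0) ((0, 0), y0))"
      using xy0 by simp
    then have "f ((l, 0), 0) = dext_scale s' (l / B (C x0) y0)
        (dext_bracket s' B' C' (f ((0, 0), x0)) (f ((0, 0), y0)))"
      by (simp only: f)
    then show ?thesis by (simp add: fx a_def)
  qed
  have a0: "a \<noteq> 0"
  proof
    assume "a = 0"
    then have "f ((1, 0), 0) = f 0" by (simp add: fX f(6) zero_prod_def)
    from inj[OF this] show False by (simp add: zero_prod_def)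
  qed
  obtain l1 m1 z where fY: "f ((0, 1), 0) = ((l1, m1), z)" by (metis surj_pair)
  have f_all: "f ((l, m), x) = ((l * a + m * l1 + \<phi> x, m * m1), s' m z + Q x)" for l m x
  proof -
    have "((l, m), x) = ((l, 0), 0) + dext_scale s m ((0, 1), 0) + ((0, 0), x)" by simp
    then have "f ((l, m), x) = f ((l, 0), 0) + dext_scale s' m (f ((0, 1), 0)) + f ((0, 0), x)"
      by (simp only: f)
    then show ?thesis by (simp add: fX fY fx)
  qed
  have m1: "m1 \<noteq> 0"
  proof
    assume "m1 = 0"
    then have "snd (fst (f x)) = 0" for x by (cases x rule: dext_cases) (simp add: f_all)
    then have "snd (fst (y :: 'b dext)) = 0" for y using f(5) by metis
    from this[of "((0, 1), 0)"] show False by simp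
  qed
  have CQ: "C' (Q x) = s' (1 / m1) (Q (C x))" for x
  proof -
    have "f (dext_bracket s B C ((0, 1), 0) ((0, 0), x)) =
          dext_bracket s' B' C' ((l1, m1), z) ((\<phi> x, 0), Q x)"
      by (simp only: f(3) fY fx)
    then have "Q (C x) = s' m1 (C' (Q x))" by (simp add: f_all q.C_zero q.form_zero)
    then show ?thesis using m1 by simp
  qed
  have form: "B' (Q (C x)) (Q y) = (a * m1) * B (C x) y" for x y
  proof -
    have "f (dext_bracket s B C ((0, 0), x) ((0, 0), y)) =
          dext_bracket s' B' C' ((\<phi> x, 0), Q x) ((\<phi> y, 0), Q y)"
      by (simp only: f(3) fx)
    then have "B (C x) y * a = B' (C' (Q x)) (Q y)" by (simp add: fX)
    then show ?thesis using m1 by (simp add: CQ r.form_scale field_simps)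
  qed
  have "inj Q"
  proof (rule injI)
    fix x y assume "Q x = Q y"
    then have "f ((- \<phi> x / a, 0), x) = f ((- \<phi> y / a, 0), y)" using a0 by (simp add: f_all)
    from inj[OF this] show "x = y" by simp
  qed
  moreover have "\<exists>x. y = Q x" for y
  proof -
    obtain l m x where "inv f ((0, 0), y) = ((l, m), x)" by (metis surj_pair)
    then have "f ((l, m), x) = ((0, 0), y)" using f(5) by metis
    then show ?thesis using m1 by (auto simp: f_all)
  qed
  ultimately have "linear_iso s s' Q"
    using q.vector_space_axioms r.vector_space_axioms Q_add Q_scale
    by (auto simp: linear_iso_def Vector_Spaces.linear_iff bij_def surj_def)
  then show thesis
    by (rule that[OF _ _ _ CQ form]) (use m1 a0 in \<open>simp_all add: fx\<close>)
qed

lemma linear_iso_scale: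
  assumes "linear_iso s s' Q" "c \<noteq> 0"
  shows "linear_iso s s' (\<lambda>x. s' c (Q x))"
proof -
  have "bij (\<lambda>y. s' c y)"
    using assms(2) by (intro o_bij[of "\<lambda>y. s' (1 / c) y"]) (auto simp: fun_eq_iff)
  then have "bij (\<lambda>x. s' c (Q x))"
    using assms(1) bij_comp[of Q "\<lambda>y. s' c y"] by (simp add: linear_iso_def comp_def)
  then show ?thesis
    using assms(1)
    by (simp add: linear_iso_def Vector_Spaces.linear_iff r.scale_right_distrib mult.commute)
qed

text \<open>Scaling \<open>X\<^sub>1\<close> by \<open>c\<close> and \<open>Y\<^sub>1\<close> by \<open>1 / c\<close> keeps the hyperbolic plane isometric while absorbing
  the factor \<open>c\<close> in both kinds of brackets.\<close>

lemma g_iso_from_conjugacy: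
  assumes "linear_iso s s' Q" "c \<noteq> 0"
    and "\<And>x. C' (Q x) = s' c (Q (C x))" "\<And>x y. B' (Q (C x)) (Q y) = B (C x) y"
  defines "f \<equiv> \<lambda>((l, m), x). ((c * l, m / c), Q x)"
  shows "g_iso f"
    and "(\<And>x y. B' (Q x) (Q y) = B x y) \<Longrightarrow> dext_form B' (f z) (f w) = dext_form B z w"
proof -
  have lin: "vector_space s" "vector_space s'" "Q (x + y) = Q x + Q y" "Q (s k x) = s' k (Q x)"
    and bij: "bij Q" for x y k
    using assms(1) by (auto simp: linear_iso_def Vector_Spaces.linear_iff)
  have diff: "Q (x - y) = Q x - Q y" for x y using lin(3)[of "x - y" y] by simp
  have vs: "vector_space (dext_scale s)" "vector_space (dext_scale s')"
    using double_extension_quadratic_lie_algebra[OF q.quadratic_space_axioms q.skew_symmetric]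
      double_extension_quadratic_lie_algebra[OF r.quadratic_space_axioms r.skew_symmetric]
    by (auto simp: quadratic_lie_algebra_def quadratic_space_def complex_fd_space_def)
  have inv: "inv Q (Q x) = x" "Q (inv Q y) = y" for x y
    using bij by (simp_all add: bij_is_inj bij_is_surj surj_f_inv_f)
  have "bij f"
    by (rule o_bij[of "\<lambda>((l, m), x). ((l / c, m * c), inv Q x)"])
      (auto simp: fun_eq_iff f_def inv assms(2))
  moreover have "Vector_Spaces.linear (dext_scale s) (dext_scale s') f"
    using vs by (auto simp: Vector_Spaces.linear_iff f_def lin algebra_simps add_divide_distrib)
  moreover have "f (dext_bracket s B C x y) = dext_bracket s' B' C' (f x) (f y)" for x y
    using assms(2)
    by (cases x rule: dext_cases; cases y rule: dext_cases)
      (simp add: f_def assms(3,4) lin diff r.form_scale)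
  ultimately show "g_iso f" by (simp add: lie_iso_def linear_iso_def)
  show "dext_form B' (f z) (f w) = dext_form B z w" if "\<And>x y. B' (Q x) (Q y) = B x y"
    using assms(2) that
    by (cases z rule: dext_cases; cases w rule: dext_cases) (simp add: f_def)
qed

end

section \<open>Classification of double extensions\<close>

theorem corollary5p6:
  fixes s :: "complex \<Rightarrow> 'a::ab_group_add \<Rightarrow> 'a" and s' :: "complex \<Rightarrow> 'b::ab_group_add \<Rightarrow> 'b"
    and B :: "'a \<Rightarrow> 'a \<Rightarrow> complex" and B' :: "'b \<Rightarrow> 'b \<Rightarrow> complex"
    and C :: "'a \<Rightarrow> 'a" and C' :: "'b \<Rightarrow> 'b"
  assumes "quadratic_space s B" and "quadratic_space s' B'"
    and "skew_symmetric_map s B C" and "skew_symmetric_map s' B' C'"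
  shows "((\<exists>f. i_iso (dext_scale s) (dext_form B) (dext_bracket s B C)
                     (dext_scale s') (dext_form B') (dext_bracket s' B' C') f) \<longleftrightarrow>
          (\<exists>A. isometry s B s' B' A \<and>
               (\<exists>c. c \<noteq> 0 \<and> C' = (\<lambda>x. s' c (A (C (inv A x))))))) \<and>
         ((\<exists>f. lie_iso (dext_scale s) (dext_bracket s B C)
                       (dext_scale s') (dext_bracket s' B' C') f) \<longleftrightarrow>
          (\<exists>Q P. linear_iso s s' Q \<and> linear_iso s s P \<and>
               (\<exists>c. c \<noteq> 0 \<and> C' = (\<lambda>x. s' c (Q (C (inv Q x))))) \<and>
               form_adjoint B P \<circ> P \<circ> C = C \<and>
               isometry s B s' B' (Q \<circ> inv P)))"
    (is "((\<exists>f. ?i_iso f) \<longleftrightarrow> ?isometric) \<and> ((\<exists>f. ?lie_iso f) \<longleftrightarrow> ?linear)")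
proof -
  interpret double_extension_pair s B C s' B' C'
    using assms by (simp add: double_extension_pair_def skew_map_def skew_map_axioms_def)
  have isometric: ?isometric
    if "isometry s B s' B' A" "c \<noteq> 0" "\<forall>x. C' (A x) = s' c (A (C x))" for A c
    using that conjugate_iff[of A c] unfolding isometry_def by blast
  have "?isometric" if i: "?i_iso f" for f
  proof -
    have lie: "g_iso f" and isom: "dext_form B' (f x) (f y) = dext_form B x y" for x y
      using i unfolding i_iso_def isometry_def by blast+
    consider A where "isometry s B s' B' A" "\<forall>x. C' (A x) = s' 1 (A (C x))"
      | "C \<noteq> (\<lambda>_. 0)" "\<And>a. snd (fst a) = 0 \<Longrightarrow> snd (fst (f a)) = 0"
      using isometry_or_preserved[OF lie] by blast
    then show ?thesis
    proof cases
      case 1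
      then show ?thesis using isometric[of _ 1] by simp
    next
      case 2
      obtain Q c where Q: "linear_iso s s' Q" "c \<noteq> 0" "\<And>x. C' (Q x) = s' c (Q (C x))"
        "\<And>x y. dext_form B' (f ((0, 0), x)) (f ((0, 0), y)) = B' (Q x) (Q y)"
        using linear_part_of_preserving_iso[OF lie 2] by metis
      have "B' (Q x) (Q y) = B x y" for x y
        using Q(4)[of x y] isom by simp
      then show ?thesis using isometric[of Q c] Q by (simp add: isometry_def)
    qed
  qed
  moreover have "\<exists>f. ?i_iso f" if conj: ?isometric
  proof -
    obtain A c where A: "isometry s B s' B' A" "c \<noteq> 0" "\<And>x. C' (A x) = s' c (A (C x))"
      using conj conjugate_iff unfolding isometry_def by metis
    then have lin: "linear_iso s s' A" and isom: "B' (A x) (A y) = B x y" for x y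
      by (auto simp: isometry_def)
    note f = g_iso_from_conjugacy[OF lin A(2,3) isom]
    show ?thesis
      using f(1) f(2)[OF isom] unfolding i_iso_def isometry_def lie_iso_def by blast
  qed
  moreover have ?linear if lie: "?lie_iso f" for f
  proof -
    obtain Q c where Q: "linear_iso s s' Q" "c \<noteq> 0" "\<And>x. C' (Q x) = s' c (Q (C x))"
      "\<And>x y. B' (Q (C x)) (Q y) = B (C x) y"
    proof (cases "\<exists>A. isometry s B s' B' A \<and> (\<forall>x. C' (A x) = s' 1 (A (C x)))")
      case True
      then show ?thesis using that[of _ 1] unfolding isometry_def by force
    next
      case False
      then have pres: "C \<noteq> (\<lambda>_. 0)" "\<And>a. snd (fst a) = 0 \<Longrightarrow> snd (fst (f a)) = 0"
        using isometry_or_preserved[OF lie] by blast+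
      obtain Q c k where Q: "linear_iso s s' Q" "c \<noteq> 0" "k \<noteq> 0"
        "\<And>x. C' (Q x) = s' c (Q (C x))" "\<And>x y. B' (Q (C x)) (Q y) = k * B (C x) y"
        using linear_part_of_preserving_iso[OF lie pres] by metis
      define t where "t = 1 / csqrt k"
      have t: "t \<noteq> 0" "t * t * k = 1"
        using Q(3) power2_csqrt[of k] by (simp_all add: t_def power2_eq_square field_simps)
      show ?thesis
      proof (rule that[OF linear_iso_scale[OF Q(1) t(1)] Q(2)])
        show "C' (s' t (Q x)) = s' c (s' t (Q (C x)))" for x
          by (simp add: r.C_scale Q(4) mult.commute)
        show "B' (s' t (Q (C x))) (s' t (Q y)) = B (C x) y" for x y
          using t(2) by (simp add: r.form_scale Q(5) mult.assoc[symmetric])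
      qed
    qed
    obtain A where A: "isometry s B s' B' A" using isometry_exists[OF lie] .
    then have A': "linear_iso s s' A" "bij A" and isom: "B' (A x) (A y) = B x y" for x y
      by (auto simp: isometry_def linear_iso_def)
    \<comment> \<open>Any isometry will do, because \<open>P\<^sup>* P = Q\<^sup>* Q\<close> for \<open>P = A\<^sup>-\<^sup>1 Q\<close>.\<close>
    define P where "P = inv A \<circ> Q"
    have AP: "A (P x) = Q x" for x
      using A'(2) by (simp add: P_def bij_is_surj surj_f_inv_f)
    have P: "linear_iso s s P"
      using linear_iso_inv[OF A'(1)] Q(1)
      by (auto simp: P_def linear_iso_def Vector_Spaces.linear_iff intro: bij_comp)
    have "Q \<circ> inv P = A"
      using P AP by (auto simp: fun_eq_iff linear_iso_def bij_is_surj surj_f_inv_f simp flip: AP)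
    moreover have "form_adjoint B P (P (C x)) = C x" for x
    proof (rule q.eq_by_form)
      fix y
      have "B (form_adjoint B P (P (C x))) y = B (P y) (P (C x))"
        using P q.form_adjoint[of P y "P (C x)"] q.form_sym by (simp add: linear_iso_def)
      also have "\<dots> = B' (Q (C x)) (Q y)" by (simp add: q.form_sym isom flip: AP)
      finally show "B (form_adjoint B P (P (C x))) y = B (C x) y" by (simp add: Q(4))
    qed
    ultimately show ?thesis
      using Q(1-3) P A conjugate_iff[OF Q(1), of c]
      by (intro exI[of _ Q] exI[of _ P]) (auto simp: comp_def)
  qed
  moreover have "\<exists>f. ?lie_iso f" if conj: ?linear
  proof -
    obtain Q P c where Q: "linear_iso s s' Q" "linear_iso s s P" "c \<noteq> 0"
        "\<And>x. C' (Q x) = s' c (Q (C x))"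
      and PC: "form_adjoint B P \<circ> P \<circ> C = C" and A: "isometry s B s' B' (Q \<circ> inv P)"
      using conj conjugate_iff by metis
    have "inv P (P x) = x" for x using Q(2) by (simp add: linear_iso_def bij_is_inj)
    then have QP: "B' (Q x) (Q y) = B (P x) (P y)" for x y
      using A unfolding isometry_def by (metis comp_apply)
    have "B' (Q (C x)) (Q y) = B (C x) y" for x y
    proof -
      have "B' (Q (C x)) (Q y) = B (P y) (P (C x))" by (simp add: QP q.form_sym)
      also have "\<dots> = B y (form_adjoint B P (P (C x)))"
        using Q(2) by (simp add: q.form_adjoint linear_iso_def)
      also have "form_adjoint B P (P (C x)) = C x" using fun_cong[OF PC, of x] by simp
      finally show ?thesis by (simp add: q.form_sym)
    qed
    from g_iso_from_conjugacy(1)[OF Q(1,3,4) this] show ?thesis by blast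
  qed
  ultimately show ?thesis by blast
qed

end
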